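(* Let $(C,\le)$ be a causal set, fix an integer $r>2$ and a real $K>0$, and suppose that $\kappa_r(\gamma)\ge K$ for all maximising geodesics $\gamma=(x_0,\dots,x_{n+r})$ in $C$ and all integers $n\ge r$. Then for every such $\gamma$ $$\tau(x_0,x_{n+r})\le r+\frac{J_r(\gamma)}{K},\qquad\text{where}\quad J_r(\gamma):=r-\ell_1(\delta_{x_0},\mu_{x_0})-\ell_1(\mu_{x_n},\delta_{x_{n+r}}).$$ Moreover, if $\mathrm{diam}_\tau(C)\ge 2r$, then $$\mathrm{diam}_\tau(C)\le r+\frac{\sup_\gamma J_r(\gamma)}{K},$$ where the supremum is over all maximising geodesics $\gamma=(x_0,\dots,x_{n+r})$ with $n\ge r$; and for each such $\gamma$ $$J_r(\gamma)\le r-2-\frac{(r-2)(r+1)}{2}\left(\frac1{N_x}+\frac1{N_y}\right)<r-2.$$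
   Context: A causal set is a pair $(C,\le)$ where $\le$ is a partial order on the set $C$ such that every causal diamond $J(x,z)=\{y\in C:x\le y\le z\}$ is finite. Write $x\ll y$ if $x\le y$ and $x\ne y$. The time separation is $\tau(x,y)=\max\{m: x=z_0\ll z_1\ll\dots\ll z_m=y\}$ if $x\le y$, and $\tau(x,y)=0$ otherwise; $\mathrm{diam}_\tau(C)=\sup\{\tau(x,y):x\le y\}$. A chain $x_0\ll\dots\ll x_m$ is a (maximising) geodesic if $m=\tau(x_0,x_m)$. For finitely supported probability measures $\mu,\nu$ on $C$, $\ell_1(\mu,\nu)=\max_\pi\sum_{a,b}\pi(a,b)\tau(a,b)$ over couplings $\pi$ of $\mu,\nu$ with $\pi(a,b)=0$ whenever $a\not\le b$ ($-\infty$ if none exist). For integers $n\ge r\ge1$ and a maximising geodesic $\gamma=(x_0,\dots,x_{n+r})$, put $x=x_0$, $y=x_n$, $N_x=|J(x,x_r)|$, $N_y=|J(y,x_{n+r})|$; $\mu_x=\mu_{x_0}$ is the uniform probability measure on $J(x,x_r)$, $\mu_y=\mu_{x_n}$ the uniform probability measure on $J(y,x_{n+r})$, and $\kappa_r(\gamma)=\frac{\ell_1(\mu_x,\mu_y)}{\tau(x,y)}-1$. $\delta_z$ is the Dirac mass at $z$. *)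

theory Defs
  imports "HOL-Probability.Probability"
begin

definition diamond :: "'a set \<Rightarrow> 'a rel \<Rightarrow> 'a \<Rightarrow> 'a \<Rightarrow> 'a set" where
  "diamond C R x z = {y \<in> C. (x, y) \<in> R \<and> (y, z) \<in> R}"

definition causal_set :: "'a set \<Rightarrow> 'a rel \<Rightarrow> bool" where
  "causal_set C R \<longleftrightarrow>
     partial_order_on C R \<and> (\<forall>x\<in>C. \<forall>z\<in>C. finite (diamond C R x z))"

text \<open>A finite sequence \<open>x\<^sub>0, \<dots>, x\<^sub>m\<close> is given by a function on the naturals together with
  the last index \<open>m\<close>; its values beyond \<open>m\<close> play no role.\<close>

definition chain :: "'a set \<Rightarrow> 'a rel \<Rightarrow> (nat \<Rightarrow> 'a) \<Rightarrow> nat \<Rightarrow> bool" where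
  "chain C R z m \<longleftrightarrow>
     (\<forall>i\<le>m. z i \<in> C) \<and> (\<forall>i<m. (z i, z (Suc i)) \<in> R \<and> z i \<noteq> z (Suc i))"

text \<open>In a causal set the chain lengths below form a finite nonempty set
  whenever \<open>(x, y) \<in> R\<close>, so the maximum is genuine.\<close>

definition tau :: "'a set \<Rightarrow> 'a rel \<Rightarrow> 'a \<Rightarrow> 'a \<Rightarrow> nat" where
  "tau C R x y =
     (if (x, y) \<in> R then Max {m. \<exists>z. chain C R z m \<and> z 0 = x \<and> z m = y} else 0)"

definition diam_tau :: "'a set \<Rightarrow> 'a rel \<Rightarrow> ereal" where
  "diam_tau C R = Sup {ereal (real (tau C R x y)) | x y. x \<in> C \<and> y \<in> C \<and> (x, y) \<in> R}"

definition geodesic :: "'a set \<Rightarrow> 'a rel \<Rightarrow> (nat \<Rightarrow> 'a) \<Rightarrow> nat \<Rightarrow> bool" where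
  "geodesic C R \<gamma> m \<longleftrightarrow> chain C R \<gamma> m \<and> m = tau C R (\<gamma> 0) (\<gamma> m)"

definition causal_couplings :: "'a rel \<Rightarrow> 'a pmf \<Rightarrow> 'a pmf \<Rightarrow> ('a \<times> 'a) pmf set" where
  "causal_couplings R \<mu> \<nu> =
     {\<pi>. map_pmf fst \<pi> = \<mu> \<and> map_pmf snd \<pi> = \<nu> \<and> (\<forall>a b. (a, b) \<notin> R \<longrightarrow> pmf \<pi> (a, b) = 0)}"

text \<open>Intended for finitely supported \<open>\<mu>\<close>, \<open>\<nu>\<close> only. Every coupling is then supported in the
  finite set over which the sum ranges, and the supremum is a maximum of a continuous function on
  a compact polytope, unless there is no causal coupling, in which case it is
  \<open>Sup {} = -\<infinity>\<close>.\<close>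

definition ell1 :: "'a set \<Rightarrow> 'a rel \<Rightarrow> 'a pmf \<Rightarrow> 'a pmf \<Rightarrow> ereal" where
  "ell1 C R \<mu> \<nu> =
     (SUP \<pi> \<in> causal_couplings R \<mu> \<nu>.
        ereal (\<Sum>(a, b) \<in> set_pmf \<mu> \<times> set_pmf \<nu>. pmf \<pi> (a, b) * real (tau C R a b)))"

definition mu :: "'a set \<Rightarrow> 'a rel \<Rightarrow> nat \<Rightarrow> (nat \<Rightarrow> 'a) \<Rightarrow> nat \<Rightarrow> 'a pmf" where
  "mu C R r \<gamma> i = pmf_of_set (diamond C R (\<gamma> i) (\<gamma> (i + r)))"

text \<open>In the next two definitions \<open>\<gamma>\<close> stands for the geodesic \<open>(\<gamma> 0, \<dots>, \<gamma> (n + r))\<close>.\<close>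

definition kappa :: "'a set \<Rightarrow> 'a rel \<Rightarrow> nat \<Rightarrow> nat \<Rightarrow> (nat \<Rightarrow> 'a) \<Rightarrow> ereal" where
  "kappa C R r n \<gamma> =
     ell1 C R (mu C R r \<gamma> 0) (mu C R r \<gamma> n) / ereal (real (tau C R (\<gamma> 0) (\<gamma> n))) - 1"

definition J_defect :: "'a set \<Rightarrow> 'a rel \<Rightarrow> nat \<Rightarrow> nat \<Rightarrow> (nat \<Rightarrow> 'a) \<Rightarrow> ereal" where
  "J_defect C R r n \<gamma> =
     ereal (real r)
       - ell1 C R (return_pmf (\<gamma> 0)) (mu C R r \<gamma> 0)
       - ell1 C R (mu C R r \<gamma> n) (return_pmf (\<gamma> (n + r)))"

end

theory Submission
  imports Defs
begin

text \<open>
  Any coupling \<open>\<pi>\<close> of \<open>\<mu>\<^sub>x\<close> and \<open>\<mu>\<^sub>y\<close> is supported on causal pairs \<open>(a, b)\<close> with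
  \<open>x\<^sub>0 \<le> a \<le> b \<le> x\<^sub>n\<^sub>+\<^sub>r\<close>, so averaging the reverse triangle inequality
  \<open>\<tau>(x\<^sub>0, a) + \<tau>(a, b) + \<tau>(b, x\<^sub>n\<^sub>+\<^sub>r) \<le> n + r\<close> against \<open>\<pi>\<close> bounds \<open>\<ell>\<^sub>1(\<mu>\<^sub>x, \<mu>\<^sub>y)\<close> by \<open>n + J\<^sub>r\<close>.
  The curvature bound makes it at least \<open>n (1 + K)\<close>, hence \<open>n K \<le> J\<^sub>r\<close>.
  For the bound on \<open>J\<^sub>r\<close>, every point of \<open>J(x\<^sub>0, x\<^sub>r)\<close> other than \<open>x\<^sub>0\<close> has time separation at
  least 1 from \<open>x\<^sub>0\<close>, and the point \<open>x\<^sub>i\<close> of the geodesic has at least \<open>i\<close>; summing gives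
  \<open>N\<^sub>x + (r - 2) (r + 1) / 2\<close>.
\<close>

section \<open>Concatenation and segments of chains\<close>

lemma chain_append:
  assumes "chain C R z m" "chain C R w k" "z m = w 0"
  shows "chain C R (\<lambda>i. if i \<le> m then z i else w (i - m)) (m + k)"
  unfolding chain_def
proof (intro conjI allI impI)
  fix i assume "i \<le> m + k"
  then show "(if i \<le> m then z i else w (i - m)) \<in> C"
    using assms by (auto simp: chain_def)
next
  fix i assume i: "i < m + k"
  have "((if i \<le> m then z i else w (i - m)), if Suc i \<le> m then z (Suc i) else w (Suc i - m)) \<in> R
    \<and> (if i \<le> m then z i else w (i - m)) \<noteq> (if Suc i \<le> m then z (Suc i) else w (Suc i - m))"
  proof (cases "i < m")
    case True
    then show ?thesis using assms by (auto simp: chain_def)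
  next
    case False
    \<comment> \<open>At the junction \<open>i = m\<close> the first branch gives
      \<open>z m\<close>, which equals \<open>w 0\<close>; so from index \<open>m\<close> on the
      sequence is just \<open>w\<close> shifted by \<open>m\<close>.\<close>
    then have "(if i \<le> m then z i else w (i - m)) = w (i - m)"
      using assms(3) by auto
    moreover have "Suc i - m = Suc (i - m)" "i - m < k"
      using False i by auto
    ultimately show ?thesis
      using assms(2) False by (simp add: chain_def)
  qed
  then show "((if i \<le> m then z i else w (i - m)), if Suc i \<le> m then z (Suc i) else w (Suc i - m)) \<in> R"
    and "(if i \<le> m then z i else w (i - m)) \<noteq> (if Suc i \<le> m then z (Suc i) else w (Suc i - m))"
    by blast+
qed

lemma chain_segment:
  assumes "chain C R z m" "i + k \<le> m"
  shows "chain C R (\<lambda>j. z (i + j)) k"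
  using assms by (auto simp: chain_def)

section \<open>Couplings as expectations and transport from or to a Dirac mass\<close>

lemma sum_coupling_eq_expectation:
  fixes f :: "'a \<Rightarrow> 'b \<Rightarrow> real"
  assumes "finite (set_pmf (map_pmf fst \<pi>))" "finite (set_pmf (map_pmf snd \<pi>))"
  shows "(\<Sum>(a, b) \<in> set_pmf (map_pmf fst \<pi>) \<times> set_pmf (map_pmf snd \<pi>). pmf \<pi> (a, b) * f a b)
    = measure_pmf.expectation \<pi> (\<lambda>p. f (fst p) (snd p))"
proof -
  \<comment> \<open>The support of a coupling lies in the product of the supports of its marginals,
    so the finite sum in \<open>ell1\<close> misses no mass.\<close>
  have "measure_pmf.expectation \<pi> (\<lambda>p. f (fst p) (snd p))
     = (\<Sum>p\<in>set_pmf (map_pmf fst \<pi>) \<times> set_pmf (map_pmf snd \<pi>). f (fst p) (snd p) * pmf \<pi> p)"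
    using assms by (intro integral_measure_pmf_real finite_cartesian_product) (force simp: mem_Times_iff)+
  then show ?thesis
    by (simp add: case_prod_unfold mult.commute)
qed

text \<open>Under any coupling with a Dirac mass at \<open>x\<close> the first coordinate is almost
  surely \<open>x\<close>, so all couplings have the same value. Since
  \<open>map_pmf (Pair x) \<mu>\<close> is a causal one, the supremum is over a nonempty constant
  family.\<close>

lemma ell1_return_left:
  assumes "finite (set_pmf \<mu>)" "\<And>a. a \<in> set_pmf \<mu> \<Longrightarrow> (x, a) \<in> R"
  shows "ell1 C R (return_pmf x) \<mu> = ereal (measure_pmf.expectation \<mu> (\<lambda>a. real (tau C R x a)))"
proof -
  have "map_pmf (Pair x) \<mu> \<in> causal_couplings R (return_pmf x) \<mu>"
    using assms by (auto simp: causal_couplings_def pmf_eq_0_set_pmf map_pmf_comp)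
  moreover have "(\<Sum>(a, b) \<in> set_pmf (return_pmf x) \<times> set_pmf \<mu>. pmf \<pi> (a, b) * real (tau C R a b))
      = measure_pmf.expectation \<mu> (\<lambda>a. real (tau C R x a))"
    if "\<pi> \<in> causal_couplings R (return_pmf x) \<mu>" for \<pi>
  proof -
    have m: "map_pmf fst \<pi> = return_pmf x" "map_pmf snd \<pi> = \<mu>"
      using that by (auto simp: causal_couplings_def)
    have "fst p = x" if "p \<in> set_pmf \<pi>" for p
    proof -
      have "fst p \<in> set_pmf (map_pmf fst \<pi>)" using that by auto
      then show ?thesis using m by simp
    qed
    then have "measure_pmf.expectation \<pi> (\<lambda>p. real (tau C R (fst p) (snd p)))
        = measure_pmf.expectation \<pi> (\<lambda>p. real (tau C R x (snd p)))"
      by (intro integral_cong_AE) (auto simp: AE_measure_pmf_iff)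
    also have "\<dots> = measure_pmf.expectation \<mu> (\<lambda>a. real (tau C R x a))"
      by (simp flip: m(2))
    finally show ?thesis
      using sum_coupling_eq_expectation[of \<pi> "\<lambda>a b. real (tau C R a b)"] assms(1) unfolding m by simp
  qed
  ultimately show ?thesis
    unfolding ell1_def by (intro SUP_eq_const) auto
qed

lemma ell1_return_right:
  assumes "finite (set_pmf \<mu>)" "\<And>a. a \<in> set_pmf \<mu> \<Longrightarrow> (a, x) \<in> R"
  shows "ell1 C R \<mu> (return_pmf x) = ereal (measure_pmf.expectation \<mu> (\<lambda>a. real (tau C R a x)))"
proof -
  have "map_pmf (\<lambda>a. (a, x)) \<mu> \<in> causal_couplings R \<mu> (return_pmf x)"
    using assms by (auto simp: causal_couplings_def pmf_eq_0_set_pmf map_pmf_comp)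
  moreover have "(\<Sum>(a, b) \<in> set_pmf \<mu> \<times> set_pmf (return_pmf x). pmf \<pi> (a, b) * real (tau C R a b))
      = measure_pmf.expectation \<mu> (\<lambda>a. real (tau C R a x))"
    if "\<pi> \<in> causal_couplings R \<mu> (return_pmf x)" for \<pi>
  proof -
    have m: "map_pmf fst \<pi> = \<mu>" "map_pmf snd \<pi> = return_pmf x"
      using that by (auto simp: causal_couplings_def)
    have "snd p = x" if "p \<in> set_pmf \<pi>" for p
    proof -
      have "snd p \<in> set_pmf (map_pmf snd \<pi>)" using that by auto
      then show ?thesis using m by simp
    qed
    then have "measure_pmf.expectation \<pi> (\<lambda>p. real (tau C R (fst p) (snd p)))
        = measure_pmf.expectation \<pi> (\<lambda>p. real (tau C R (fst p) x))"
      by (intro integral_cong_AE) (auto simp: AE_measure_pmf_iff)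
    also have "\<dots> = measure_pmf.expectation \<mu> (\<lambda>a. real (tau C R a x))"
      by (simp flip: m(1))
    finally show ?thesis
      using sum_coupling_eq_expectation[of \<pi> "\<lambda>a b. real (tau C R a b)"] assms(1) unfolding m by simp
  qed
  ultimately show ?thesis
    unfolding ell1_def by (intro SUP_eq_const) auto
qed

text \<open>The \<open>r + 1\<close> points of the sequence contribute at least 0 + 1 + ... + r =
  r(r+1)/2. The other \<open>card S - (r + 1)\<close> points differ from \<open>p 0\<close> and
  contribute at least 1 each. The constant is r(r+1)/2 - (r+1) = (r-2)(r+1)/2.\<close>

lemma sum_ge_along_sequence:
  fixes f :: "'a \<Rightarrow> nat"
  assumes fin: "finite S" and inj: "inj_on p {..r}" and sub: "p ` {..r} \<subseteq> S"
    and ge: "\<And>i. i \<le> r \<Longrightarrow> i \<le> f (p i)" and pos: "\<And>a. a \<in> S \<Longrightarrow> a \<noteq> p 0 \<Longrightarrow> 1 \<le> f a"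
  shows "real (card S) + (real r - 2) * (real r + 1) / 2 \<le> (\<Sum>a\<in>S. real (f a))"
proof -
  have gauss: "(\<Sum>i\<le>r. real i) = real r * (real r + 1) / 2"
    by (induction r) (simp_all add: field_simps)
  have cardp: "card (p ` {..r}) = Suc r"
    using inj by (simp add: card_image)
  have "card (S - p ` {..r}) + Suc r = card S"
    using fin sub cardp card_mono[OF fin sub] by (simp add: card_Diff_subset)
  then have card: "real (card (S - p ` {..r})) + (real r + 1) = real (card S)"
    by (metis of_nat_Suc of_nat_add add.commute)
  have "(\<Sum>i\<le>r. real i) \<le> (\<Sum>i\<le>r. real (f (p i)))"
    using ge by (intro sum_mono) auto
  also have "\<dots> = (\<Sum>a\<in>p ` {..r}. real (f a))"
    using inj by (simp add: sum.reindex)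
  finally have 1: "real r * (real r + 1) / 2 \<le> (\<Sum>a\<in>p ` {..r}. real (f a))"
    by (simp add: gauss)
  have "(\<Sum>a\<in>S - p ` {..r}. 1) \<le> (\<Sum>a\<in>S - p ` {..r}. real (f a))"
    using pos by (intro sum_mono) force
  then have 2: "real (card (S - p ` {..r})) \<le> (\<Sum>a\<in>S - p ` {..r}. real (f a))"
    by simp
  have "(\<Sum>a\<in>S. real (f a)) = (\<Sum>a\<in>S - p ` {..r}. real (f a)) + (\<Sum>a\<in>p ` {..r}. real (f a))"
    by (rule sum.subset_diff[OF sub fin])
  with 1 2 card show ?thesis
    by (simp add: field_simps)
qed

section \<open>Chains and time separation in a causal set\<close>

context
  fixes C :: "'a set" and R :: "'a rel"
  assumes causal: "causal_set C R"
begin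

lemma causal_refl: "x \<in> C \<Longrightarrow> (x, x) \<in> R"
  using causal by (auto simp: causal_set_def partial_order_on_def preorder_on_def refl_on_def)

lemma causal_trans: "(x, y) \<in> R \<Longrightarrow> (y, z) \<in> R \<Longrightarrow> (x, z) \<in> R"
  using causal by (auto simp: causal_set_def partial_order_on_def preorder_on_def elim: transE)

lemma causal_antisym: "(x, y) \<in> R \<Longrightarrow> (y, x) \<in> R \<Longrightarrow> x = y"
  using causal by (auto simp: causal_set_def partial_order_on_def antisym_def)

lemma finite_diamond: "x \<in> C \<Longrightarrow> z \<in> C \<Longrightarrow> finite (diamond C R x z)"
  using causal by (auto simp: causal_set_def)

lemma chain_le:
  assumes "chain C R z m" "i \<le> j" "j \<le> m"
  shows "(z i, z j) \<in> R"
  using assms(2,3)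
proof (induction j rule: dec_induct)
  case base
  then show ?case using assms(1) by (auto simp: chain_def intro: causal_refl)
next
  case (step k)
  then have "(z k, z (Suc k)) \<in> R" using assms(1) by (auto simp: chain_def)
  with step show ?case by (meson Suc_leD causal_trans)
qed

text \<open>If \<open>z i = z j\<close>, then \<open>z (Suc i)\<close> is squeezed between
  \<open>z i\<close> and itself, so antisymmetry contradicts the strictness of the step at
  \<open>i\<close>.\<close>

lemma chain_less_neq:
  assumes "chain C R z m" "i < j" "j \<le> m"
  shows "z i \<noteq> z j"
proof
  assume eq: "z i = z j"
  have 1: "(z i, z (Suc i)) \<in> R" "z i \<noteq> z (Suc i)"
    using assms by (auto simp: chain_def)
  have "(z (Suc i), z j) \<in> R"
    using assms by (intro chain_le) auto
  with 1 eq causal_antisym show False by metis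
qed

lemma chain_inj_on: "chain C R z m \<Longrightarrow> inj_on z {..m}"
  by (rule linorder_inj_onI) (auto dest: chain_less_neq)

lemma chain_subset_diamond:
  assumes "chain C R z m"
  shows "z ` {..m} \<subseteq> diamond C R (z 0) (z m)"
  using assms chain_le[OF assms] by (auto simp: diamond_def chain_def)

text \<open>A chain of length \<open>m\<close> consists of \<open>m + 1\<close> distinct points of
  one finite diamond, which bounds \<open>m\<close>. This is what makes the \<open>Max\<close> in
  \<open>tau\<close> a genuine maximum.\<close>

lemma finite_chain_lengths:
  assumes "x \<in> C" "y \<in> C"
  shows "finite {m. \<exists>z. chain C R z m \<and> z 0 = x \<and> z m = y}"
proof (rule finite_subset)
  show "{m. \<exists>z. chain C R z m \<and> z 0 = x \<and> z m = y} \<subseteq> {..card (diamond C R x y)}"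
  proof clarsimp
    fix m z assume z: "chain C R z m"
      and xy: "x = z 0" "y = z m"
    have "card (z ` {..m}) \<le> card (diamond C R (z 0) (z m))"
      using chain_subset_diamond[OF z] finite_diamond[OF assms] unfolding xy by (intro card_mono)
    then show "m \<le> card (diamond C R (z 0) (z m))"
      using chain_inj_on[OF z] by (simp add: card_image)
  qed
qed simp

lemma chain_length_le_tau:
  assumes "chain C R z m"
  shows "m \<le> tau C R (z 0) (z m)"
proof -
  have "(z 0, z m) \<in> R" using assms by (intro chain_le) auto
  moreover have "z 0 \<in> C" "z m \<in> C" using assms by (auto simp: chain_def)
  ultimately show ?thesis
    using assms by (auto simp: tau_def intro!: Max_ge finite_chain_lengths)
qed

lemma tau_attained:
  assumes "x \<in> C" "y \<in> C" "(x, y) \<in> R"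
  obtains z where "chain C R z (tau C R x y)" "z 0 = x" "z (tau C R x y) = y"
proof -
  let ?M = "{m. \<exists>z. chain C R z m \<and> z 0 = x \<and> z m = y}"
  have "?M \<noteq> {}"
  \<comment> \<open>The one-step chain from \<open>x\<close> to \<open>y\<close> needs distinct
    endpoints; for \<open>x = y\<close> the chain of length 0 takes its place.\<close>
  proof (cases "x = y")
    case True
    then have "chain C R (\<lambda>_. x) 0 \<and> x = x \<and> x = y" using assms by (auto simp: chain_def)
    then show ?thesis by blast
  next
    case False
    then have "chain C R (\<lambda>i. if i = 0 then x else y) 1" using assms by (auto simp: chain_def)
    then have "1 \<in> ?M" using False by (intro CollectI exI) auto
    then show ?thesis by blast
  qed
  then have "Max ?M \<in> ?M"
    using assms by (intro Max_in finite_chain_lengths)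
  then show ?thesis
    using that assms(3) by (auto simp: tau_def)
qed

text \<open>Two longest chains, glued at \<open>y\<close>, form a chain from \<open>x\<close> to
  \<open>z\<close> that competes in the maximum defining \<open>tau C R x z\<close>.\<close>

lemma tau_reverse_triangle:
  assumes "x \<in> C" "y \<in> C" "z \<in> C" "(x, y) \<in> R" "(y, z) \<in> R"
  shows "tau C R x y + tau C R y z \<le> tau C R x z"
proof -
  obtain u where u: "chain C R u (tau C R x y)" "u 0 = x" "u (tau C R x y) = y"
    by (rule tau_attained[OF assms(1,2,4)])
  obtain w where w: "chain C R w (tau C R y z)" "w 0 = y" "w (tau C R y z) = z"
    by (rule tau_attained[OF assms(2,3,5)])
  have "u (tau C R x y) = w 0" using u w by simp
  \<comment> \<open>If \<open>tau C R y z = 0\<close>, the last index of the glued chain falls into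
    the branch of \<open>u\<close>; then \<open>y = w 0 = z\<close>, so the endpoint is still
    \<open>z\<close>.\<close>
  from chain_length_le_tau[OF chain_append[OF u(1) w(1) this]]
  show ?thesis using u w by (auto split: if_splits)
qed

lemma tau_pos:
  assumes "x \<in> C" "y \<in> C" "(x, y) \<in> R" "x \<noteq> y"
  shows "1 \<le> tau C R x y"
proof -
  have "chain C R (\<lambda>i. if i = 0 then x else y) 1" using assms by (auto simp: chain_def)
  from chain_length_le_tau[OF this] show ?thesis by simp
qed

lemma chain_segment_le_tau:
  assumes "chain C R \<gamma> m" "i + k \<le> m"
  shows "k \<le> tau C R (\<gamma> i) (\<gamma> (i + k))"
  using chain_length_le_tau[OF chain_segment[OF assms]] by simp

text \<open>The two segments give separations of at least \<open>n\<close> and \<open>r\<close>,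
  while the reverse triangle inequality caps their sum at \<open>n + r\<close>, so neither has
  slack. This identifies the denominator in \<open>kappa\<close> as \<open>n\<close>.\<close>

lemma geodesic_tau_initial:
  assumes "geodesic C R \<gamma> (n + r)"
  shows "tau C R (\<gamma> 0) (\<gamma> n) = n"
proof -
  have ch: "chain C R \<gamma> (n + r)" and t: "tau C R (\<gamma> 0) (\<gamma> (n + r)) = n + r"
    using assms by (auto simp: geodesic_def)
  have "n \<le> tau C R (\<gamma> 0) (\<gamma> n)" "r \<le> tau C R (\<gamma> n) (\<gamma> (n + r))"
    using chain_segment_le_tau[OF ch, of 0 n] chain_segment_le_tau[OF ch, of n r] by auto
  moreover have "tau C R (\<gamma> 0) (\<gamma> n) + tau C R (\<gamma> n) (\<gamma> (n + r)) \<le> tau C R (\<gamma> 0) (\<gamma> (n + r))"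
    using ch by (intro tau_reverse_triangle chain_le[OF ch]) (auto simp: chain_def)
  ultimately show ?thesis using t by simp
qed

section \<open>Uniform measures on diamonds, the transport bound and its use with curvature\<close>

lemma set_pmf_mu:
  assumes "chain C R \<gamma> m" "i + r \<le> m"
  shows "set_pmf (mu C R r \<gamma> i) = diamond C R (\<gamma> i) (\<gamma> (i + r))"
    and "finite (diamond C R (\<gamma> i) (\<gamma> (i + r)))"
    and "diamond C R (\<gamma> i) (\<gamma> (i + r)) \<noteq> {}"
proof -
  show fin: "finite (diamond C R (\<gamma> i) (\<gamma> (i + r)))"
    using assms by (intro finite_diamond) (auto simp: chain_def)
  show ne: "diamond C R (\<gamma> i) (\<gamma> (i + r)) \<noteq> {}"
    using chain_subset_diamond[OF chain_segment[OF assms]] by force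
  \<comment> \<open>\<open>pmf_of_set\<close> has its intended meaning only on finite nonempty sets,
    hence the two facts before.\<close>
  show "set_pmf (mu C R r \<gamma> i) = diamond C R (\<gamma> i) (\<gamma> (i + r))"
    using fin ne by (simp add: mu_def)
qed

text \<open>Both Dirac transports are finite expectations, so the defect is a real number; later
  estimates can thus leave the extended reals.\<close>

lemma J_defect_eq:
  assumes "chain C R \<gamma> (n + r)"
  shows "J_defect C R r n \<gamma> = ereal (real r
    - measure_pmf.expectation (mu C R r \<gamma> 0) (\<lambda>a. real (tau C R (\<gamma> 0) a))
    - measure_pmf.expectation (mu C R r \<gamma> n) (\<lambda>b. real (tau C R b (\<gamma> (n + r)))))"
proof -
  note \<mu> = set_pmf_mu[OF assms, of 0 r, simplified]
  note \<nu> = set_pmf_mu[OF assms, of n r, simplified]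
  have "ell1 C R (return_pmf (\<gamma> 0)) (mu C R r \<gamma> 0)
      = ereal (measure_pmf.expectation (mu C R r \<gamma> 0) (\<lambda>a. real (tau C R (\<gamma> 0) a)))"
    using \<mu>(2) by (intro ell1_return_left) (auto simp: \<mu>(1) diamond_def)
  moreover have "ell1 C R (mu C R r \<gamma> n) (return_pmf (\<gamma> (n + r)))
      = ereal (measure_pmf.expectation (mu C R r \<gamma> n) (\<lambda>b. real (tau C R b (\<gamma> (n + r)))))"
    using \<nu>(2) by (intro ell1_return_right) (auto simp: \<nu>(1) diamond_def)
  ultimately show ?thesis
    by (simp add: J_defect_def)
qed

text \<open>The bound is shown for each causal coupling and then passes to the supremum; an empty
  family gives minus infinity on the left. The two outer terms of the triangle inequality depend on
  one coordinate each, so they integrate to the expectations in \<open>J_defect_eq\<close>.\<close>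

lemma ell1_le:
  assumes geo: "geodesic C R \<gamma> (n + r)"
  shows "ell1 C R (mu C R r \<gamma> 0) (mu C R r \<gamma> n) \<le> ereal (real n) + J_defect C R r n \<gamma>"
proof -
  have ch: "chain C R \<gamma> (n + r)" and t: "tau C R (\<gamma> 0) (\<gamma> (n + r)) = n + r"
    using geo by (auto simp: geodesic_def)
  have \<gamma>C: "\<gamma> i \<in> C" if "i \<le> n + r" for i
    using ch that by (auto simp: chain_def)
  let ?\<mu> = "mu C R r \<gamma> 0" and ?\<nu> = "mu C R r \<gamma> n"
  let ?f = "\<lambda>a. real (tau C R (\<gamma> 0) a)" and ?g = "\<lambda>b. real (tau C R b (\<gamma> (n + r)))"
  let ?t = "\<lambda>a b. real (tau C R a b)"
  note \<mu> = set_pmf_mu[OF ch, of 0 r, simplified]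
  note \<nu> = set_pmf_mu[OF ch, of n r, simplified]
  have "(\<Sum>(a, b) \<in> set_pmf ?\<mu> \<times> set_pmf ?\<nu>. pmf \<pi> (a, b) * ?t a b)
      \<le> real n + (real r - measure_pmf.expectation ?\<mu> ?f - measure_pmf.expectation ?\<nu> ?g)"
    if \<pi>: "\<pi> \<in> causal_couplings R ?\<mu> ?\<nu>" for \<pi>
  proof -
    have m: "map_pmf fst \<pi> = ?\<mu>" "map_pmf snd \<pi> = ?\<nu>"
      and cau: "\<And>a b. (a, b) \<notin> R \<Longrightarrow> pmf \<pi> (a, b) = 0"
      using \<pi> by (auto simp: causal_couplings_def)
    have supp: "fst p \<in> set_pmf ?\<mu>" "snd p \<in> set_pmf ?\<nu>" "(fst p, snd p) \<in> R"
      if "p \<in> set_pmf \<pi>" for p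
      using that cau[of "fst p" "snd p"] by (auto simp: set_pmf_iff simp flip: m)
    \<comment> \<open>Finite support makes every function integrable, which linearity and
      monotonicity below rely on.\<close>
    have fin: "finite (set_pmf \<pi>)"
      by (rule finite_subset[of _ "set_pmf ?\<mu> \<times> set_pmf ?\<nu>"]) (use supp \<mu> \<nu> in \<open>auto simp: mem_Times_iff\<close>)
    note int = integrable_measure_pmf_finite[OF fin]
    have "?f (fst p) + ?t (fst p) (snd p) + ?g (snd p) \<le> real (n + r)" if p: "p \<in> set_pmf \<pi>" for p
    proof -
      have a: "fst p \<in> C" "(\<gamma> 0, fst p) \<in> R" and b: "snd p \<in> C" "(snd p, \<gamma> (n + r)) \<in> R"
        and ab: "(fst p, snd p) \<in> R"
        using supp[OF p] \<mu>(1) \<nu>(1) by (auto simp: diamond_def)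
      have "tau C R (\<gamma> 0) (fst p) + tau C R (fst p) (snd p) \<le> tau C R (\<gamma> 0) (snd p)"
        using a b ab \<gamma>C by (intro tau_reverse_triangle) auto
      moreover have "tau C R (\<gamma> 0) (snd p) + tau C R (snd p) (\<gamma> (n + r)) \<le> tau C R (\<gamma> 0) (\<gamma> (n + r))"
        using a b ab \<gamma>C by (intro tau_reverse_triangle) (auto intro: causal_trans)
      ultimately show ?thesis using t by linarith
    qed
    then have "measure_pmf.expectation \<pi> (\<lambda>p. ?f (fst p) + ?t (fst p) (snd p) + ?g (snd p))
        \<le> measure_pmf.expectation \<pi> (\<lambda>p. real (n + r))"
      by (intro integral_mono_AE int) (auto simp: AE_measure_pmf_iff)
    moreover have "measure_pmf.expectation \<pi> (\<lambda>p. ?f (fst p) + ?t (fst p) (snd p) + ?g (snd p))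
        = measure_pmf.expectation \<pi> (\<lambda>p. ?f (fst p))
          + measure_pmf.expectation \<pi> (\<lambda>p. ?t (fst p) (snd p))
          + measure_pmf.expectation \<pi> (\<lambda>p. ?g (snd p))"
      by (simp add: int)
    moreover have "measure_pmf.expectation \<pi> (\<lambda>p. ?f (fst p)) = measure_pmf.expectation ?\<mu> ?f"
      by (simp flip: m(1))
    moreover have "measure_pmf.expectation \<pi> (\<lambda>p. ?g (snd p)) = measure_pmf.expectation ?\<nu> ?g"
      by (simp flip: m(2))
    moreover have "measure_pmf.expectation \<pi> (\<lambda>p. ?t (fst p) (snd p))
        = (\<Sum>(a, b) \<in> set_pmf ?\<mu> \<times> set_pmf ?\<nu>. pmf \<pi> (a, b) * ?t a b)"
      using sum_coupling_eq_expectation[of \<pi> ?t] \<mu> \<nu> unfolding m by simp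
    ultimately show ?thesis by simp
  qed
  then show ?thesis
    unfolding J_defect_eq[OF ch] ell1_def by (auto intro!: SUP_least)
qed

text \<open>With denominator \<open>n\<close>, the curvature bound and \<open>ell1_le\<close> give K
  <= (n + j)/n - 1 = j/n for the finite value \<open>j\<close> of the defect. This is stated without
  dividing by \<open>K\<close>, so the sign of \<open>K\<close> is free here.\<close>

lemma kappa_bound_imp_le_J_defect:
  assumes geo: "geodesic C R \<gamma> (n + r)" and "n > 0" and "kappa C R r n \<gamma> \<ge> ereal K"
  shows "ereal (real n * K) \<le> J_defect C R r n \<gamma>"
proof -
  have ch: "chain C R \<gamma> (n + r)"
    using geo by (simp add: geodesic_def)
  then obtain j where j: "J_defect C R r n \<gamma> = ereal j"
    using J_defect_eq by blast
  have "ereal K \<le> ell1 C R (mu C R r \<gamma> 0) (mu C R r \<gamma> n) / ereal (real n) - 1"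
    using assms(3) geodesic_tau_initial[OF geo] by (simp add: kappa_def)
  also have "\<dots> \<le> ereal (real n + j) / ereal (real n) - 1"
    using ell1_le[OF geo] \<open>n > 0\<close> j by (intro ereal_minus_mono ereal_divide_right_mono) auto
  also have "\<dots> = ereal ((real n + j) / real n - 1)"
    using \<open>n > 0\<close> by (metis ereal_divide ereal_minus(1) one_ereal_def of_nat_0_less_iff less_irrefl)
  also have "(real n + j) / real n - 1 = j / real n"
    using \<open>n > 0\<close> by (simp add: add_divide_distrib)
  finally have "K \<le> j / real n"
    by simp
  then have "real n * K \<le> j"
    using \<open>n > 0\<close> by (simp add: pos_le_divide_eq mult.commute)
  then show ?thesis
    by (simp add: j)
qed

lemma geodesic_tau_le:
  assumes geo: "geodesic C R \<gamma> (n + r)" and "n > 0" "K > 0" and "kappa C R r n \<gamma> \<ge> ereal K"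
  shows "ereal (real (n + r)) \<le> ereal (real r) + J_defect C R r n \<gamma> / ereal K"
proof -
  have "chain C R \<gamma> (n + r)"
    using geo by (simp add: geodesic_def)
  then obtain j where j: "J_defect C R r n \<gamma> = ereal j"
    using J_defect_eq by blast
  have "real n * K \<le> j"
    using kappa_bound_imp_le_J_defect[OF geo \<open>n > 0\<close> assms(4)] j by simp
  then have "real (n + r) \<le> real r + j / K"
    using \<open>K > 0\<close> by (simp add: pos_le_divide_eq)
  moreover have "ereal (real r + j / K) = ereal (real r) + J_defect C R r n \<gamma> / ereal K"
    using \<open>K > 0\<close> by (simp add: j)
  ultimately show ?thesis
    by (metis ereal_less_eq(3))
qed

section \<open>Upper bound on the defect by counting points in diamonds\<close>

lemma expectation_mu_ge:
  fixes f :: "'a \<Rightarrow> nat"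
  assumes ch: "chain C R \<gamma> m" and le: "i + r \<le> m"
    and p: "inj_on p {..r}" "p ` {..r} \<subseteq> diamond C R (\<gamma> i) (\<gamma> (i + r))"
      "\<And>k. k \<le> r \<Longrightarrow> k \<le> f (p k)"
    and pos: "\<And>a. a \<in> diamond C R (\<gamma> i) (\<gamma> (i + r)) \<Longrightarrow> a \<noteq> p 0 \<Longrightarrow> 1 \<le> f a"
  shows "1 + (real r - 2) * (real r + 1) / 2 * (1 / real (card (diamond C R (\<gamma> i) (\<gamma> (i + r)))))
    \<le> measure_pmf.expectation (mu C R r \<gamma> i) (\<lambda>a. real (f a))"
proof -
  let ?D = "diamond C R (\<gamma> i) (\<gamma> (i + r))"
  note D = set_pmf_mu[OF ch le]
  have c: "real (card ?D) > 0"
    using D(2,3) by (simp add: card_gt_0_iff)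
  have "measure_pmf.expectation (mu C R r \<gamma> i) (\<lambda>a. real (f a)) = (\<Sum>a\<in>?D. real (f a)) / real (card ?D)"
    unfolding mu_def by (rule integral_pmf_of_set) (use D(2,3) in auto)
  also have "\<dots> \<ge> (real (card ?D) + (real r - 2) * (real r + 1) / 2) / real (card ?D)"
    using sum_ge_along_sequence[OF D(2) p pos] by (intro divide_right_mono) auto
  finally show ?thesis
    using c by (simp add: add_divide_distrib)
qed

text \<open>Each of the two averages is at least 1 + c/N with c = (r-2)(r+1)/2 and N the size of its
  diamond; subtracting both from \<open>r\<close> leaves r - 2 - c(1/N + 1/N'). The averages come
  from \<open>expectation_mu_ge\<close>, whose sequence \<open>p\<close> is the geodesic read
  forwards at one end and backwards at the other.\<close>

lemma J_defect_le:
  assumes ch: "chain C R \<gamma> (n + r)"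
  shows "J_defect C R r n \<gamma> \<le> ereal (real r - 2 - (real r - 2) * (real r + 1) / 2
    * (1 / real (card (diamond C R (\<gamma> 0) (\<gamma> r))) + 1 / real (card (diamond C R (\<gamma> n) (\<gamma> (n + r))))))"
proof -
  have \<gamma>C: "\<gamma> i \<in> C" if "i \<le> n + r" for i
    using ch that by (auto simp: chain_def)
  have inj: "inj_on \<gamma> {..n + r}"
    by (rule chain_inj_on[OF ch])
  have "1 + (real r - 2) * (real r + 1) / 2 * (1 / real (card (diamond C R (\<gamma> 0) (\<gamma> (0 + r)))))
      \<le> measure_pmf.expectation (mu C R r \<gamma> 0) (\<lambda>a. real (tau C R (\<gamma> 0) a))"
  proof (rule expectation_mu_ge[OF ch, where p = \<gamma>])
    show "inj_on \<gamma> {..r}" by (rule inj_on_subset[OF inj]) auto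
    show "\<gamma> ` {..r} \<subseteq> diamond C R (\<gamma> 0) (\<gamma> (0 + r))"
      using chain_subset_diamond[OF chain_segment[OF ch, of 0 r]] by simp
    show "k \<le> tau C R (\<gamma> 0) (\<gamma> k)" if "k \<le> r" for k
      using chain_segment_le_tau[OF ch, of 0 k] that by simp
    show "1 \<le> tau C R (\<gamma> 0) a" if "a \<in> diamond C R (\<gamma> 0) (\<gamma> (0 + r))" "a \<noteq> \<gamma> 0" for a
      using that \<gamma>C by (intro tau_pos) (auto simp: diamond_def)
  qed simp
  moreover have "1 + (real r - 2) * (real r + 1) / 2 * (1 / real (card (diamond C R (\<gamma> n) (\<gamma> (n + r)))))
      \<le> measure_pmf.expectation (mu C R r \<gamma> n) (\<lambda>b. real (tau C R b (\<gamma> (n + r))))"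
  \<comment> \<open>Here separation is measured to the endpoint, so the segment is reversed:
    \<open>p k\<close> lies \<open>k\<close> steps before \<open>\<gamma> (n + r)\<close>, and
    \<open>p 0\<close> is that endpoint, exempt from the lower bound 1.\<close>
  proof (rule expectation_mu_ge[OF ch, where p = "\<lambda>k. \<gamma> (n + (r - k))"])
    show "inj_on (\<lambda>k. \<gamma> (n + (r - k))) {..r}"
    proof (rule inj_onI)
      fix k l assume "k \<in> {..r}" "l \<in> {..r}" and eq: "\<gamma> (n + (r - k)) = \<gamma> (n + (r - l))"
      moreover have "n + (r - k) = n + (r - l)"
        by (rule inj_onD[OF inj eq]) auto
      ultimately show "k = l" by auto
    qed
    show "(\<lambda>k. \<gamma> (n + (r - k))) ` {..r} \<subseteq> diamond C R (\<gamma> n) (\<gamma> (n + r))"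
    proof clarify
      fix k
      have "\<gamma> (n + (r - k)) \<in> (\<lambda>j. \<gamma> (n + j)) ` {..r}" by (rule imageI) simp
      then show "\<gamma> (n + (r - k)) \<in> diamond C R (\<gamma> n) (\<gamma> (n + r))"
        using chain_subset_diamond[OF chain_segment[OF ch, of n r]] by auto
    qed
    show "k \<le> tau C R (\<gamma> (n + (r - k))) (\<gamma> (n + r))" if "k \<le> r" for k
      using chain_segment_le_tau[OF ch, of "n + (r - k)" k] that by simp
    show "1 \<le> tau C R b (\<gamma> (n + r))"
      if "b \<in> diamond C R (\<gamma> n) (\<gamma> (n + r))" "b \<noteq> \<gamma> (n + (r - 0))" for b
      using that \<gamma>C by (intro tau_pos) (auto simp: diamond_def)
  qed simp
  ultimately show ?thesis
    unfolding J_defect_eq[OF ch] by (simp add: distrib_left)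
qed

section \<open>From bounds on long geodesics to a bound on the diameter\<close>

lemma diam_tau_le:
  assumes large: "ereal (real m) \<le> diam_tau C R" "m > 0"
    and bound: "\<And>\<gamma> k. m \<le> k \<Longrightarrow> geodesic C R \<gamma> k \<Longrightarrow> ereal (real k) \<le> B"
  shows "diam_tau C R \<le> B"
proof -
  have ge: "ereal (real (tau C R x y)) \<le> B"
    if "x \<in> C" "y \<in> C" "(x, y) \<in> R" and le: "m \<le> tau C R x y" for x y
  proof -
    obtain z where "chain C R z (tau C R x y)" "z 0 = x" "z (tau C R x y) = y"
      by (rule tau_attained[OF \<open>x \<in> C\<close> \<open>y \<in> C\<close> \<open>(x, y) \<in> R\<close>])
    then show ?thesis using bound[OF le, of z] by (simp add: geodesic_def)
  qed
  \<comment> \<open>The hypothesis on the supremum must yield an actual pair. As \<open>tau\<close>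
    takes integer values, without such a pair the supremum would be at most
    \<open>m - 1\<close>.\<close>
  obtain x y where xy: "x \<in> C" "y \<in> C" "(x, y) \<in> R" "m \<le> tau C R x y"
  proof (rule ccontr)
    assume *: "\<not> thesis"
    have "diam_tau C R \<le> ereal (real (m - 1))"
      unfolding diam_tau_def
    proof (rule Sup_least, clarify)
      fix x y assume "x \<in> C" "y \<in> C" "(x, y) \<in> R"
      then have "tau C R x y < m" using * that not_less by blast
      then show "ereal (real (tau C R x y)) \<le> ereal (real (m - 1))" by simp
    qed
    with large(1) have "ereal (real m) \<le> ereal (real (m - 1))" by (rule order_trans)
    with large(2) show False by simp
  qed
  show ?thesis
    unfolding diam_tau_def
  proof (rule Sup_least, clarify)
    fix u v assume uv: "u \<in> C" "v \<in> C" "(u, v) \<in> R"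
    show "ereal (real (tau C R u v)) \<le> B"
    proof (cases "m \<le> tau C R u v")
      case True
      then show ?thesis using ge uv by blast
    next
      case False
      \<comment> \<open>A pair with separation below \<open>m\<close> is out of reach of
        \<open>bound\<close>, but it is dominated by the long pair \<open>x\<close>,
        \<open>y\<close>.\<close>
      then have "ereal (real (tau C R u v)) \<le> ereal (real (tau C R x y))" using xy by simp
      also have "\<dots> \<le> B" using ge xy by blast
      finally show ?thesis .
    qed
  qed
qed

end

theorem theorem3p9:
  fixes C :: "'a set" and R :: "'a rel" and r :: nat and K :: real
  assumes "causal_set C R"
    and "r > 2"
    and "K > 0"
    and "\<And>n \<gamma>. n \<ge> r \<Longrightarrow> geodesic C R \<gamma> (n + r) \<Longrightarrow> kappa C R r n \<gamma> \<ge> ereal K"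
  shows "(\<forall>n \<gamma>. n \<ge> r \<and> geodesic C R \<gamma> (n + r) \<longrightarrow>
            ereal (real (tau C R (\<gamma> 0) (\<gamma> (n + r)))) \<le> ereal (real r) + J_defect C R r n \<gamma> / ereal K)
       \<and> (diam_tau C R \<ge> ereal (2 * real r) \<longrightarrow>
            diam_tau C R \<le> ereal (real r)
              + Sup {J_defect C R r n \<gamma> | n \<gamma>. n \<ge> r \<and> geodesic C R \<gamma> (n + r)} / ereal K)
       \<and> (\<forall>n \<gamma>. n \<ge> r \<and> geodesic C R \<gamma> (n + r) \<longrightarrow>
            (let N\<^sub>x = real (card (diamond C R (\<gamma> 0) (\<gamma> r)));
                 N\<^sub>y = real (card (diamond C R (\<gamma> n) (\<gamma> (n + r))));
                 B = real r - 2 - (real r - 2) * (real r + 1) / 2 * (1 / N\<^sub>x + 1 / N\<^sub>y)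
             in J_defect C R r n \<gamma> \<le> ereal B \<and> B < real r - 2))"
proof (intro conjI allI impI)
  note bound = geodesic_tau_le[OF assms(1) _ _ assms(3) assms(4)]
  {
    fix n \<gamma> assume *: "n \<ge> r \<and> geodesic C R \<gamma> (n + r)"
    then have "tau C R (\<gamma> 0) (\<gamma> (n + r)) = n + r" by (simp add: geodesic_def)
    then show "ereal (real (tau C R (\<gamma> 0) (\<gamma> (n + r)))) \<le> ereal (real r) + J_defect C R r n \<gamma> / ereal K"
      using bound[of \<gamma> n] * assms(2) by simp
  next
    let ?J = "{J_defect C R r n \<gamma> | n \<gamma>. n \<ge> r \<and> geodesic C R \<gamma> (n + r)}"
    assume "ereal (2 * real r) \<le> diam_tau C R"
    then have large: "ereal (real (2 * r)) \<le> diam_tau C R" by simp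
    show "diam_tau C R \<le> ereal (real r) + Sup ?J / ereal K"
    proof (rule diam_tau_le[OF assms(1) large])
      fix \<gamma> k assume k: "2 * r \<le> k" "geodesic C R \<gamma> k"
      \<comment> \<open>A geodesic of length at least \<open>2 * r\<close> splits as
        \<open>n + r\<close> with \<open>n \<ge> r\<close>, exactly the range of the curvature
        hypothesis; this is where the threshold \<open>2 * r\<close> comes from.\<close>
      define n where "n = k - r"
      have n: "k = n + r" "r \<le> n" using k by (auto simp: n_def)
      then have geo: "geodesic C R \<gamma> (n + r)" using k by simp
      have "ereal (real k) \<le> ereal (real r) + J_defect C R r n \<gamma> / ereal K"
        using bound[of \<gamma> n] geo n assms(2) by simp
      also have "\<dots> \<le> ereal (real r) + Sup ?J / ereal K"
        using geo n assms(3) by (intro add_left_mono ereal_divide_right_mono Sup_upper) auto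
      finally show "ereal (real k) \<le> ereal (real r) + Sup ?J / ereal K" .
    qed (use assms(2) in simp)
  next
    fix n \<gamma> assume *: "n \<ge> r \<and> geodesic C R \<gamma> (n + r)"
    then have ch: "chain C R \<gamma> (n + r)" by (simp add: geodesic_def)
    \<comment> \<open>Positive cardinalities rule out the default value 0 of division by zero, so
      both reciprocals are positive; with \<open>r > 2\<close> the subtracted term is positive and
      the last inequality strict.\<close>
    have "card (diamond C R (\<gamma> 0) (\<gamma> r)) > 0" "card (diamond C R (\<gamma> n) (\<gamma> (n + r))) > 0"
      using set_pmf_mu[OF assms(1) ch, of 0 r] set_pmf_mu[OF assms(1) ch, of n r]
      by (auto simp: card_gt_0_iff)
    then have "(real r - 2) * (real r + 1) / 2 * (1 / real (card (diamond C R (\<gamma> 0) (\<gamma> r)))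
        + 1 / real (card (diamond C R (\<gamma> n) (\<gamma> (n + r))))) > 0"
      using assms(2) by (intro mult_pos_pos divide_pos_pos add_pos_pos) auto
    then show "let N\<^sub>x = real (card (diamond C R (\<gamma> 0) (\<gamma> r)));
                 N\<^sub>y = real (card (diamond C R (\<gamma> n) (\<gamma> (n + r))));
                 B = real r - 2 - (real r - 2) * (real r + 1) / 2 * (1 / N\<^sub>x + 1 / N\<^sub>y)
             in J_defect C R r n \<gamma> \<le> ereal B \<and> B < real r - 2"
      using J_defect_le[OF assms(1) ch] unfolding Let_def by simp
  }
qed

end
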